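(* Let $q>0$, $q\neq 1$. Let $S_q$ be a real-valued quantity that assigns to every finite probability distribution $\{p_i\}_{i=1,2,\ldots,W}$ ($W\ge 1$, $p_i\ge 0$, $\sum_{i=1}^W p_i=1$) a number $S_q(p_1,p_2,\ldots,p_W)$, and suppose it satisfies the following three axioms. (I) For each $W$, $S_q(p_1,p_2,\ldots,p_W)$ is continuous with respect to all its arguments and takes its maximum for the equiprobability distribution $p_i=1/W$ $(i=1,2,\ldots,W)$. (II) For every composite system $(A,B)$ with joint probability distribution $p_{ij}(A,B)$ $(i=1,\ldots,W;\ j=1,\ldots,U)$, $$S_q[A,B]=S_q[A]+S_q[B|A]+(1-q)\,S_q[A]\,S_q[B|A],$$ where $S_q[B|A]$ is the nonextensive conditional entropy. (III) For every $W$ and every probability distribution $(p_1,\ldots,p_W)$, $S_q(p_1,p_2,\ldots,p_W,0)=S_q(p_1,p_2,\ldots,p_W)$. Then $S_q$ is uniquely equal to the Tsallis entropy, i.e. for every $W$ and every probability distribution $(p_1,\ldots,p_W)$, $$S_q(p_1,p_2,\ldots,p_W)=\frac{1}{1-q}\left[\sum_{i=1}^{W}(p_i)^q-1\right].$$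
   Context: A system $A$ is a finite collection of events with a probability distribution, and $S_q[A]$ denotes the value of $S_q$ at that distribution; it is a property of the system, so it does not depend on the order in which the probabilities are listed. For a composite system $(A,B)$ with joint distribution $p_{ij}(A,B)$ $(i=1,\ldots,W;\ j=1,\ldots,U)$: - $S_q[A,B]$ is the value of $S_q$ at the joint distribution, regarded as a probability distribution on $WU$ events. - $S_q[A]$ is the value of $S_q$ at the marginal distribution $p_i(A)=\sum_{j=1}^{U}p_{ij}(A,B)$. - The conditional distribution is $p_{ij}(B|A)=p_{ij}(A,B)/p_i(A)$, and $S_q[B|A_i]$ is the value of $S_q$ at the distribution $(p_{i1}(B|A),\ldots,p_{iU}(B|A))$, for each $i$ with $p_i(A)>0$. - The nonextensive conditional entropy is $$S_q[B|A]=\frac{\sum_{i=1}^{W}[p_i(A)]^q\,S_q[B|A_i]}{\sum_{i=1}^{W}[p_i(A)]^q},$$ where terms with $p_i(A)=0$ contribute zero. The convention $0^q=0$ is used (recall $q>0$).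
   Formalization: In axiom (I) the maximum is assumed to be attained only at the equiprobability distribution (strict maximum); with a non-strict maximum the constant quantity S_q = 0 satisfies all three axioms but is not the Tsallis entropy. *)

theory Defs
  imports "HOL-Analysis.Analysis" "HOL-Library.Multiset"
begin

definition prob_dist :: "real list \<Rightarrow> bool" where
  "prob_dist p \<longleftrightarrow> p \<noteq> [] \<and> (\<forall>x\<in>set p. 0 \<le> x) \<and> sum_list p = 1"

definition equiprob :: "nat \<Rightarrow> real list" where
  "equiprob W = replicate W (1 / real W)"

(* A joint distribution is the list of its W rows, each of length U; read row by row
   (concat) it is a distribution on W * U events. *)
definition joint_dist :: "nat \<Rightarrow> nat \<Rightarrow> real list list \<Rightarrow> bool" where
  "joint_dist W U P \<longleftrightarrow>
     length P = W \<and> (\<forall>r\<in>set P. length r = U) \<and> prob_dist (concat P)"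

definition marginal :: "real list list \<Rightarrow> real list" where
  "marginal P = map sum_list P"

definition conditional :: "real list \<Rightarrow> real list" where
  "conditional r = map (\<lambda>x. x / sum_list r) r"

(* Since 0 powr q = 0, rows of probability zero contribute zero to both sums, whatever
   value S takes at the corresponding (meaningless) conditional list. *)
definition cond_entropy :: "real \<Rightarrow> (real list \<Rightarrow> real) \<Rightarrow> real list list \<Rightarrow> real" where
  "cond_entropy q S P =
     (\<Sum>r\<leftarrow>P. (sum_list r) powr q * S (conditional r)) / (\<Sum>r\<leftarrow>P. (sum_list r) powr q)"

(* S is a quantity of the system: the order in which the probabilities are listed is
   irrelevant. *)
definition order_independent :: "(real list \<Rightarrow> real) \<Rightarrow> bool" where
  "order_independent S \<longleftrightarrow> (\<forall>p p'. prob_dist p \<and> mset p' = mset p \<longrightarrow> S p' = S p)"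

(* Joint continuity on the simplex of distributions with W events.  Lists carry no
   topology, so the W arguments are the first W coordinates of a point of the product
   space nat => real; the remaining coordinates do not enter. *)
definition continuous_entropy :: "(real list \<Rightarrow> real) \<Rightarrow> bool" where
  "continuous_entropy S \<longleftrightarrow>
     (\<forall>W. continuous_on {x :: nat \<Rightarrow> real. prob_dist (map x [0..<W])}
            (\<lambda>x. S (map x [0..<W])))"

(* The maximum is attained at the equiprobability distribution and nowhere else.  With a
   non-strict inequality the constant functionals 0 and 1 / (q - 1) would satisfy all the
   axioms, and uniqueness would fail. *)
definition maximal_at_equiprob :: "(real list \<Rightarrow> real) \<Rightarrow> bool" where
  "maximal_at_equiprob S \<longleftrightarrow>
     (\<forall>W\<ge>1. \<forall>p. prob_dist p \<and> length p = W \<and> p \<noteq> equiprob W \<longrightarrow> S p < S (equiprob W))"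

definition nonextensive_additive :: "real \<Rightarrow> (real list \<Rightarrow> real) \<Rightarrow> bool" where
  "nonextensive_additive q S \<longleftrightarrow>
     (\<forall>W U P. joint_dist W U P \<longrightarrow>
        S (concat P) = S (marginal P) + cond_entropy q S P
                       + (1 - q) * S (marginal P) * cond_entropy q S P)"

definition expandable :: "(real list \<Rightarrow> real) \<Rightarrow> bool" where
  "expandable S \<longleftrightarrow> (\<forall>p. prob_dist p \<longrightarrow> S (p @ [0]) = S p)"

definition tsallis_entropy :: "real \<Rightarrow> real list \<Rightarrow> real" where
  "tsallis_entropy q p = 1 / (1 - q) * ((\<Sum>x\<leftarrow>p. x powr q) - 1)"

end

theory Submission
  imports Defs
begin

text \<open>
  Put \<open>F p = 1 + (1 - q) * S p\<close>, which turns the composition rule into a product rule, and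
  \<open>f n = F (equiprob n)\<close>. Then \<open>f\<close> is multiplicative and strictly monotone, hence a power of \<open>n\<close>.
  Grouping \<open>M\<close> equiprobable events into blocks of sizes \<open>m i\<close> determines \<open>F\<close> at the
  distribution \<open>m i / M\<close> in terms of \<open>f\<close>. The exponent is fixed by splitting one event of
  \<open>(1/2, 1/2)\<close> into two halves: computing \<open>F (1/4, 1/4, 1/2)\<close> in two ways gives
  \<open>(2 powr q * f 2 - 2) * (f 2 - 1) = 0\<close>, and \<open>f 2 \<noteq> 1\<close> by strict monotonicity.
  Continuity extends the formula from rational to arbitrary distributions.
\<close>

section \<open>Additive strictly increasing functions on the positive integers\<close>

text \<open>Squeeze \<open>n ^ k\<close> between consecutive powers \<open>2 ^ l\<close> and
  \<open>2 ^ (l + 1)\<close>. Both \<open>h\<close> and \<open>ln\<close> are additive and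
  increasing, so \<open>k\<close> times each of \<open>h n / h 2\<close> and
  \<open>ln n / ln 2\<close> lies between \<open>l\<close> and \<open>l + 1\<close>. The two ratios
  thus differ by at most \<open>1 / k\<close> for every positive \<open>k\<close>.\<close>

lemma strict_mono_additive_eq_ln:
  fixes h :: "nat \<Rightarrow> real"
  assumes add: "\<And>m n. 0 < m \<Longrightarrow> 0 < n \<Longrightarrow> h (m * n) = h m + h n"
    and mono: "\<And>m n. 0 < m \<Longrightarrow> m < n \<Longrightarrow> h m < h n"
    and "0 < n"
  shows "h n = h 2 / ln 2 * ln (real n)"
proof -
  have h1: "h 1 = 0" using add[of 1 1] by simp
  have h2: "0 < h 2" using mono[of 1 2] h1 by simp
  have hpow: "h (m ^ k) = real k * h m" if "0 < m" for m k
    using that by (induction k) (auto simp: h1[simplified] add algebra_simps)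
  have mono': "h a \<le> h b" if "0 < a" "a \<le> b" for a b
    using mono[of a b] that by (cases "a = b") auto
  define d where "d = h n / h 2 - ln (real n) / ln 2"
  have bound: "real k * \<bar>d\<bar> \<le> 1" for k
  proof -
    have "1 \<le> n ^ k" using \<open>0 < n\<close> by simp
    then obtain l where l: "2 ^ l \<le> n ^ k" "n ^ k < 2 ^ (l + 1)"
      using ex_power_ivl1[of 2 "n ^ k"] by auto
    have "real l * h 2 \<le> real k * h n" "real k * h n \<le> real (l + 1) * h 2"
      using mono'[OF _ l(1)] mono'[of "n ^ k" "2 ^ (l + 1)"] l(2) \<open>0 < n\<close>
        hpow[of 2 l] hpow[of 2 "l + 1"] hpow[of n k] by auto
    then have A: "real l \<le> real k * (h n / h 2)" "real k * (h n / h 2) \<le> real l + 1"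
      using h2 by (simp_all add: field_simps)
    have "real (2 ^ l) \<le> real (n ^ k)" "real (n ^ k) \<le> real (2 ^ (l + 1))"
      using l by (simp_all only: of_nat_le_iff)
    then have "ln (2 ^ l) \<le> ln (real n ^ k)" "ln (real n ^ k) \<le> ln (2 ^ (l + 1))"
      using \<open>0 < n\<close> by (simp_all del: power_Suc)
    then have "real l * ln 2 \<le> real k * ln (real n)" "real k * ln (real n) \<le> real (l + 1) * ln 2"
      using \<open>0 < n\<close> by (simp_all add: ln_realpow del: power_Suc)
    then have B: "real l \<le> real k * (ln (real n) / ln 2)" "real k * (ln (real n) / ln 2) \<le> real l + 1"
      by (simp_all add: field_simps)
    have "\<bar>real k * d\<bar> \<le> 1" unfolding d_def right_diff_distrib using A B by linarith
    then show ?thesis by (simp add: abs_mult)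
  qed
  have "d = 0"
  proof (rule ccontr)
    assume "d \<noteq> 0"
    then obtain k where "1 < real k * \<bar>d\<bar>" using reals_Archimedean3[of "\<bar>d\<bar>"] by auto
    with bound[of k] show False by simp
  qed
  then show ?thesis using h2 by (simp add: d_def field_simps)
qed

section \<open>Lists of probabilities and padded rows\<close>

lemma sum_list_nonneg_ex_pos:
  fixes p :: "real list"
  assumes "\<forall>x\<in>set p. 0 \<le> x" and "sum_list p \<noteq> 0"
  shows "\<exists>x\<in>set p. 0 < x"
  using assms sum_list_nonneg_eq_0_iff[of p] by (metis order_le_less)

lemma sum_list_concat: "sum_list (concat P) = sum_list (map sum_list P)"
  by (induction P) auto

text \<open>Up to order, rows padded to a common length form one block of \<open>x\<close> followed
  by all the padding, a shape to which order independence and expandability apply.\<close>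

lemma mset_concat_blocks:
  assumes "\<forall>n\<in>set m. n \<le> U"
  shows "mset (concat (map (\<lambda>n. replicate n x @ replicate (U - n) y) m)) =
    mset (replicate (sum_list m) x @ replicate (length m * U - sum_list m) y)"
  using assms
proof (induction m)
  case (Cons a m)
  \<comment> \<open>Subtraction on \<open>nat\<close> truncates, so the padding counts only add up
    once this bound is known.\<close>
  have "sum_list m \<le> length m * U" using Cons.prems
    sum_list_mono[of m "\<lambda>x. x" "\<lambda>_. U"] by (simp add: sum_list_triv)
  then have "length (a # m) * U - sum_list (a # m) = (U - a) + (length m * U - sum_list m)"
    using Cons.prems by simp
  then have "replicate_mset (length (a # m) * U - sum_list (a # m)) y =
      replicate_mset (U - a) y + replicate_mset (length m * U - sum_list m) y"
    by (simp only: replicate_add mset_append flip: mset_replicate)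
  then show ?case using Cons by (simp add: replicate_add flip: mset_replicate)
qed simp

lemma conditional_block:
  assumes "0 < n" "0 < M"
  shows "conditional (replicate n (1 / M) @ replicate k 0) = equiprob n @ replicate k 0"
  using assms by (simp add: conditional_def equiprob_def sum_list_replicate)

section \<open>Product form of the composition rule\<close>

text \<open>These axioms determine \<open>S\<close> at rational distributions; continuity enters
  later, in the passage to the limit.\<close>

locale tsallis_axioms =
  fixes q :: real and S :: "real list \<Rightarrow> real"
  assumes q_pos: "q > 0" and q_ne_1: "q \<noteq> 1"
    and order: "order_independent S"
    and maximal: "maximal_at_equiprob S"
    and additive: "nonextensive_additive q S"
    and expand: "expandable S"
begin

definition F :: "real list \<Rightarrow> real" where "F p = 1 + (1 - q) * S p"

definition f :: "nat \<Rightarrow> real" where "f n = F (equiprob n)"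

lemma prob_dist_equiprob: "0 < n \<Longrightarrow> prob_dist (equiprob n)"
  by (auto simp: prob_dist_def equiprob_def sum_list_replicate)

lemma prob_dist_append_zeros: "prob_dist p \<Longrightarrow> prob_dist (p @ replicate k 0)"
  by (auto simp: prob_dist_def sum_list_replicate)

lemma F_append_zeros:
  assumes "prob_dist p"
  shows "F (p @ replicate k 0) = F p"
proof (induction k)
  case (Suc k)
  have "F ((p @ replicate k 0) @ [0]) = F (p @ replicate k 0)"
    using expand prob_dist_append_zeros[OF assms] unfolding F_def expandable_def by metis
  then show ?case using Suc by (simp add: replicate_append_same)
qed simp

lemma F_mset: "prob_dist p \<Longrightarrow> mset p' = mset p \<Longrightarrow> F p' = F p"
  using order unfolding F_def order_independent_def by metis

text \<open>A weighted mean commutes with the affine map from \<open>S\<close> to \<open>F\<close>,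
  so the composition rule factors. Multiplying by the sum of the weights clears the denominator of
  the conditional entropy.\<close>

lemma F_compose:
  assumes P: "joint_dist W U P"
  shows "F (concat P) * (\<Sum>r\<leftarrow>P. (sum_list r) powr q) =
    F (marginal P) * (\<Sum>r\<leftarrow>P. (sum_list r) powr q * F (conditional r))"
proof -
  let ?Z = "\<Sum>r\<leftarrow>P. (sum_list r) powr q"
  have pd: "prob_dist (concat P)" using P by (simp add: joint_dist_def)
  have "\<forall>r\<in>set P. 0 \<le> sum_list r"
    using pd by (fastforce simp: prob_dist_def intro!: sum_list_nonneg)
  moreover have "sum_list (map sum_list P) = 1"
    using pd by (simp add: prob_dist_def sum_list_concat)
  ultimately obtain r where r: "r \<in> set P" "0 < sum_list r"
    using sum_list_nonneg_ex_pos[of "map sum_list P"] by auto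
  \<comment> \<open>A row of positive mass keeps the denominator of \<open>cond_entropy\<close> away
    from zero.\<close>
  have "?Z \<noteq> 0"
  proof
    assume "?Z = 0"
    then have "\<forall>x\<in>set (map (\<lambda>r. (sum_list r) powr q) P). x = 0"
      by (subst (asm) sum_list_nonneg_eq_0_iff) auto
    then show False using r by auto
  qed
  moreover have "(\<Sum>r\<leftarrow>P. (sum_list r) powr q * F (conditional r)) =
      ?Z + (1 - q) * (\<Sum>r\<leftarrow>P. (sum_list r) powr q * S (conditional r))"
    by (simp add: F_def algebra_simps sum_list_addf sum_list_subtractf flip: sum_list_const_mult)
  ultimately have "(\<Sum>r\<leftarrow>P. (sum_list r) powr q * F (conditional r)) =
      ?Z * (1 + (1 - q) * cond_entropy q S P)"
    by (simp add: cond_entropy_def distrib_left)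
  moreover have "F (concat P) = F (marginal P) * (1 + (1 - q) * cond_entropy q S P)"
  proof -
    have "S (concat P) = S (marginal P) + cond_entropy q S P
        + (1 - q) * S (marginal P) * cond_entropy q S P"
      using additive P unfolding nonextensive_additive_def by blast
    then show ?thesis unfolding F_def by algebra
  qed
  ultimately show ?thesis by simp
qed

text \<open>An event of probability \<open>n / M\<close> is split into \<open>n\<close> events of
  probability \<open>1 / M\<close>, which makes the joint distribution equiprobable on
  \<open>M\<close> events and each conditional one equiprobable on \<open>n\<close>. The common
  factor \<open>M powr q\<close> cancels.\<close>

lemma F_blocks:
  assumes "m \<noteq> []" and pos: "\<forall>n\<in>set m. 0 < n"
  defines "M \<equiv> sum_list m"
  shows "F (map (\<lambda>n. real n / real M) m) * (\<Sum>n\<leftarrow>m. real n powr q * f n) =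
    f M * (\<Sum>n\<leftarrow>m. real n powr q)"
proof -
  have le: "\<forall>n\<in>set m. n \<le> M" by (simp add: M_def member_le_sum_list)
  have "0 < M" using assms by (cases m) (auto simp: M_def)
  \<comment> \<open>Rows of a joint distribution share one length. Zeros fill each block up to
    \<open>M\<close>, a bound for all block sizes.\<close>
  define row where "row n = replicate n (1 / real M) @ replicate (M - n) 0" for n
  define P where "P = map row m"
  have sum_row: "sum_list (row n) = real n / real M" for n
    by (simp add: row_def sum_list_replicate)
  have mset_P: "mset (concat P) = mset (equiprob M @ replicate (length m * M - M) 0)"
    unfolding P_def row_def equiprob_def using mset_concat_blocks[OF le] by (simp add: M_def)
  have pd: "prob_dist (equiprob M @ replicate (length m * M - M) 0)"
    by (intro prob_dist_append_zeros prob_dist_equiprob \<open>0 < M\<close>)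
  have sum_P: "sum_list (concat P) = 1"
    using pd mset_P unfolding prob_dist_def by (metis sum_mset_sum_list)
  moreover have "concat P \<noteq> []" using sum_P by (metis sum_list.Nil zero_neq_one)
  moreover have "\<forall>x\<in>set (concat P). 0 \<le> x"
    using pd mset_P unfolding prob_dist_def by (metis set_mset_mset)
  ultimately have "joint_dist (length m) M P"
    using le by (auto simp: joint_dist_def prob_dist_def P_def row_def)
  from F_compose[OF this] have "F (concat P) * (\<Sum>n\<leftarrow>m. (real n / real M) powr q) =
      F (map (\<lambda>n. real n / real M) m) * (\<Sum>n\<leftarrow>m. (real n / real M) powr q * F (conditional (row n)))"
    by (simp add: P_def marginal_def sum_row comp_def)
  moreover have "F (concat P) = f M"
    using F_mset[OF pd mset_P] F_append_zeros[OF prob_dist_equiprob[OF \<open>0 < M\<close>]]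
    by (simp add: f_def)
  moreover have "(\<Sum>n\<leftarrow>m. (real n / real M) powr q * F (conditional (row n))) =
      (\<Sum>n\<leftarrow>m. real n powr q * f n) / real M powr q"
  proof -
    have "map (\<lambda>n. (real n / real M) powr q * F (conditional (row n))) m =
        map (\<lambda>n. real n powr q * f n * (1 / real M powr q)) m"
      using pos \<open>0 < M\<close>
      by (auto simp: row_def conditional_block F_append_zeros prob_dist_equiprob f_def powr_divide)
    then show ?thesis by (simp only: sum_list_mult_const) simp
  qed
  moreover have "(\<Sum>n\<leftarrow>m. (real n / real M) powr q) = (\<Sum>n\<leftarrow>m. real n powr q) / real M powr q"
    using sum_list_mult_const[of "\<lambda>n. real n powr q" "1 / real M powr q" m]
    by (simp add: powr_divide)
  ultimately show ?thesis using \<open>0 < M\<close> by (simp add: field_simps)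
qed

section \<open>Values at equiprobable distributions\<close>

text \<open>This is the case of \<open>m\<close> blocks of equal size \<open>n\<close>, where the
  marginal is itself equiprobable.\<close>

lemma f_mult:
  assumes "0 < m" "0 < n"
  shows "f (m * n) = f m * f n"
proof -
  have "map (\<lambda>k. real k / real (m * n)) (replicate m n) = equiprob m"
    using assms by (simp add: equiprob_def)
  moreover have "(\<Sum>k\<leftarrow>replicate m n. real k powr q * f k) = real m * (real n powr q * f n)"
    "(\<Sum>k\<leftarrow>replicate m n. real k powr q) = real m * real n powr q"
    by (simp_all add: sum_list_replicate)
  moreover have "sum_list (replicate m n) = m * n" by (simp add: sum_list_replicate)
  ultimately have "f m * (real m * (real n powr q * f n)) = f (m * n) * (real m * real n powr q)"
    using F_blocks[of "replicate m n"] assms unfolding f_def[of m] by simp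
  then show ?thesis using assms by (simp add: field_simps)
qed

text \<open>Appending a zero to \<open>equiprob n\<close> keeps the value of \<open>S\<close> but
  gives a distribution on \<open>n + 1\<close> events that is not equiprobable, so the strict
  maximum applies.\<close>

lemma S_equiprob_less_Suc:
  assumes "0 < n"
  shows "S (equiprob n) < S (equiprob (Suc n))"
proof -
  have "0 \<in> set (equiprob n @ [0])" "0 \<notin> set (equiprob (Suc n))"
    by (auto simp: equiprob_def)
  then have "equiprob n @ [0] \<noteq> equiprob (Suc n)" by metis
  moreover have "prob_dist (equiprob n @ [0])"
    using prob_dist_append_zeros[OF prob_dist_equiprob[OF assms], of 1] by simp
  moreover have "length (equiprob n @ [0]) = Suc n" by (simp add: equiprob_def)
  moreover have "1 \<le> Suc n" by simp
  ultimately have "S (equiprob n @ [0]) < S (equiprob (Suc n))"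
    using maximal unfolding maximal_at_equiprob_def by blast
  then show ?thesis using expand prob_dist_equiprob[OF assms] by (simp add: expandable_def)
qed

lemma S_equiprob_less:
  assumes "0 < m" "m < n"
  shows "S (equiprob m) < S (equiprob n)"
proof -
  obtain i where i: "m = Suc i" using assms by (cases m) auto
  obtain j where j: "n = Suc j" using assms by (cases n) auto
  show ?thesis
    \<comment> \<open>The index is shifted by one because the lifting rule asks for the step at
      every natural number, whereas it is known only for positive ones.\<close>
    using lift_Suc_mono_less[of "\<lambda>k. S (equiprob (Suc k))" i j] S_equiprob_less_Suc assms(2)
    by (simp add: i j)
qed

lemma f_inj: "0 < m \<Longrightarrow> m < n \<Longrightarrow> f m \<noteq> f n"
  using S_equiprob_less[of m n] q_ne_1 by (auto simp: f_def F_def)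

text \<open>A zero would propagate to \<open>n * 2\<close> and contradict injectivity. For the sign,
  \<open>f\<close> is nonnegative at squares, and \<open>f n\<close> is bounded below by
  \<open>f 1\<close> if \<open>q < 1\<close> and by \<open>f (n * n)\<close> if
  \<open>q > 1\<close>.\<close>

lemma f_pos:
  assumes "0 < n"
  shows "0 < f n"
proof -
  have nn: "0 \<le> f (k * k)" if "0 < k" for k using f_mult[of k k] that by simp
  have "f n \<noteq> 0"
  proof
    assume "f n = 0"
    then have "f (n * 2) = f n" using f_mult[of n 2] assms by simp
    then show False using f_inj[of n "n * 2"] assms by simp
  qed
  moreover have "0 \<le> f n"
  proof (cases "q < 1")
    case True
    have "S (equiprob 1) \<le> S (equiprob n)"
      using S_equiprob_less[of 1 n] assms by (cases "n = 1") auto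
    then have "f 1 \<le> f n" using True by (simp add: f_def F_def mult_left_mono)
    then show ?thesis using nn[of 1] by simp
  next
    case False
    have "S (equiprob n) \<le> S (equiprob (n * n))"
      using S_equiprob_less[of n "n * n"] assms by (cases "n = 1") auto
    then have "f (n * n) \<le> f n" using False by (simp add: f_def F_def mult_left_mono_neg)
    then show ?thesis using nn[of n] assms by simp
  qed
  ultimately show ?thesis by simp
qed

lemma f_2: "f 2 = 2 powr (1 - q)"
proof -
  \<comment> \<open>Only the first event of \<open>(1/2, 1/2)\<close> is split; the zero pads the
    second row, whose conditional distribution \<open>(1, 0)\<close> is trivial.\<close>
  define P :: "real list list" where "P = [[1/4, 1/4], [1/2, 0]]"
  have f1: "f 1 = 1" using f_mult[of 1 1] f_pos[of 1] by simp
  have pd: "prob_dist [1/4, 1/4, 1/2]" by (simp add: prob_dist_def)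
  have "joint_dist 2 2 P" by (auto simp: P_def joint_dist_def prob_dist_def)
  moreover have "F [1, 0] = f 1"
    using F_append_zeros[OF prob_dist_equiprob, of 1 1] by (simp add: f_def equiprob_def)
  moreover have "F (concat P) = F [1/4, 1/4, 1/2]"
    using F_append_zeros[OF pd, of 1] by (simp add: P_def)
  moreover have "F [1/2, 1/2] = f 2" by (simp add: f_def equiprob_def numeral_2_eq_2)
  ultimately have "(1/2) powr q * (F [1/4, 1/4, 1/2] * 2) = (1/2) powr q * (f 2 * (f 2 + 1))"
    using F_compose[of 2 2 P] f1 by (simp add: P_def marginal_def conditional_def algebra_simps)
  then have A: "F [1/4, 1/4, 1/2] * 2 = f 2 * (f 2 + 1)"
    by (simp only: mult_cancel_left) simp
  \<comment> \<open>The second computation groups four equiprobable events into blocks of sizes 1, 1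
    and 2.\<close>
  have B: "F [1/4, 1/4, 1/2] * (2 + 2 powr q * f 2) = f 4 * (2 + 2 powr q)"
    using F_blocks[of "[1, 1, 2]"] f1 by (simp add: eval_nat_numeral)
  have f4: "f 4 = f 2 * f 2" using f_mult[of 2 2] by simp
  \<comment> \<open>Eliminate \<open>F [1/4, 1/4, 1/2]\<close> between \<open>A\<close> and
    \<open>B\<close>.\<close>
  have "f 2 * ((2 powr q * f 2 - 2) * (f 2 - 1)) = 0"
    using A B unfolding f4 by algebra
  then have "2 powr q * f 2 = 2" using f_inj[of 1 2] f_pos[of 2] f1 by simp
  then show ?thesis by (simp add: powr_diff field_simps)
qed

lemma f_eq_powr:
  assumes "0 < n"
  shows "f n = real n powr (1 - q)"
proof -
  \<comment> \<open>Dividing by \<open>1 - q\<close> makes \<open>h\<close> increasing both for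
    \<open>q < 1\<close> and for \<open>q > 1\<close>; the value of \<open>f 2\<close> then gives
    \<open>h 2 = ln 2\<close>.\<close>
  define h where "h k = ln (f k) / (1 - q)" for k
  have "h (m * n) = h m + h n" if "0 < m" "0 < n" for m n
    using f_mult[OF that] f_pos[OF that(1)] f_pos[OF that(2)]
    by (simp add: h_def ln_mult add_divide_distrib)
  moreover have "h m < h n" if "0 < m" "m < n" for m n
  proof (cases "q < 1")
    case True
    then have "f m < f n" using S_equiprob_less[OF that] by (simp add: f_def F_def)
    then show ?thesis using True f_pos[of m] f_pos[of n] that
      by (simp add: h_def divide_strict_right_mono)
  next
    case False
    then have "q > 1" using q_ne_1 by simp
    then have "f n < f m" using S_equiprob_less[OF that] by (simp add: f_def F_def)
    then show ?thesis using \<open>q > 1\<close> f_pos[of m] f_pos[of n] that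
      by (simp add: h_def divide_strict_right_mono_neg)
  qed
  ultimately have "h n = h 2 / ln 2 * ln (real n)"
    using assms by (rule strict_mono_additive_eq_ln)
  then have "ln (f n) = (1 - q) * ln (real n)"
    using q_ne_1 by (simp add: h_def f_2 ln_powr field_simps)
  then show ?thesis using f_pos[OF assms] assms by (simp add: powr_def flip: exp_ln_iff)
qed

section \<open>Rational distributions\<close>

text \<open>With \<open>f n = n powr (1 - q)\<close> each product \<open>n powr q * f n\<close> is
  just \<open>n\<close>, so the weighted sum in \<open>F_blocks\<close> collapses to
  \<open>M\<close>.\<close>

lemma F_rational:
  assumes "m \<noteq> []" and pos: "\<forall>n\<in>set m. 0 < n"
  defines "p \<equiv> map (\<lambda>n. real n / real (sum_list m)) m"
  shows "F p = (\<Sum>x\<leftarrow>p. x powr q)"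
proof -
  let ?M = "sum_list m"
  have M: "0 < ?M" using assms by (cases m) auto
  have eq: "map (\<lambda>n. real n powr q * f n) m = map real m"
    using pos by (auto simp: f_eq_powr simp flip: powr_add)
  then have "F p * real ?M = real ?M powr (1 - q) * (\<Sum>n\<leftarrow>m. real n powr q)"
    using F_blocks[OF assms(1,2)] M unfolding eq p_def by (simp add: f_eq_powr sum_list_of_nat)
  moreover have "(\<Sum>x\<leftarrow>p. x powr q) = (\<Sum>n\<leftarrow>m. real n powr q) / real ?M powr q"
    using sum_list_mult_const[of "\<lambda>n. real n powr q" "1 / real ?M powr q" m]
    by (simp add: p_def comp_def powr_divide)
  ultimately have "real ?M * F p = real ?M * (\<Sum>x\<leftarrow>p. x powr q)"
    using M by (simp add: powr_diff field_simps)
  moreover have "real ?M \<noteq> 0" using M by linarith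
  ultimately show ?thesis by (simp only: mult_cancel_left) simp
qed

end

section \<open>Passage to arbitrary distributions\<close>

lemma rational_approximation:
  fixes p :: "real list"
  assumes "prob_dist p"
  obtains m :: "nat \<Rightarrow> nat list"
  where "\<And>k. length (m k) = length p" "\<And>k. \<forall>n\<in>set (m k). 0 < n"
    "\<And>i. i < length p \<Longrightarrow> (\<lambda>k. real (m k ! i) / real (sum_list (m k))) \<longlonglongrightarrow> p ! i"
proof
  \<comment> \<open>\<open>Suc\<close> keeps the numerators positive even at \<open>x = 0\<close>,
    as \<open>F_rational\<close> requires, at a cost of at most \<open>1 / k\<close>.\<close>
  define g where "g k x = Suc (nat \<lfloor>real k * x\<rfloor>)" for k x
  define m where "m k = map (g k) p" for k
  show "length (m k) = length p" "\<forall>n\<in>set (m k). 0 < n" for k by (auto simp: m_def g_def)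
  have g_lim: "(\<lambda>k. real (g k x) / real k) \<longlonglongrightarrow> x" if "0 \<le> x" for x
  proof (rule tendsto_sandwich)
    show "\<forall>\<^sub>F k in sequentially. x \<le> real (g k x) / real k"
      using eventually_gt_at_top[of 0]
    proof eventually_elim
      case (elim k)
      have "real k * x \<le> real (g k x)" unfolding g_def by linarith
      then show ?case using elim by (simp add: field_simps)
    qed
    show "\<forall>\<^sub>F k in sequentially. real (g k x) / real k \<le> x + 1 / real k"
      using eventually_gt_at_top[of 0]
    proof eventually_elim
      case (elim k)
      have "0 \<le> real k * x" using that by simp
      then have "real (g k x) \<le> real k * x + 1" unfolding g_def by linarith
      then show ?case using elim by (simp add: field_simps)
    qed
    show "(\<lambda>k. x + 1 / real k) \<longlonglongrightarrow> x"
      using tendsto_add[OF tendsto_const lim_1_over_n, of x] by simp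
  qed simp
  have nonneg: "0 \<le> x" if "x \<in> set p" for x using assms that by (simp add: prob_dist_def)
  have "(\<lambda>k. \<Sum>i<length p. real (g k (p ! i)) / real k) \<longlonglongrightarrow> (\<Sum>i<length p. p ! i)"
    by (intro tendsto_sum g_lim nonneg) simp
  moreover have "(\<Sum>i<length p. p ! i) = 1"
    using assms by (simp add: prob_dist_def sum_list_sum_nth atLeast0LessThan)
  moreover have "real (sum_list (m k)) / real k = (\<Sum>i<length p. real (g k (p ! i)) / real k)" for k
    by (simp add: m_def sum_list_sum_nth atLeast0LessThan sum_divide_distrib)
  ultimately have sum_lim: "(\<lambda>k. real (sum_list (m k)) / real k) \<longlonglongrightarrow> 1" by simp
  fix i assume i: "i < length p"
  \<comment> \<open>The numerators need not sum to \<open>k\<close>, but their sum divided by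
    \<open>k\<close> tends to 1, so normalising by it leaves the limit unchanged.\<close>
  have "(\<lambda>k. (real (g k (p ! i)) / real k) / (real (sum_list (m k)) / real k)) \<longlonglongrightarrow> p ! i / 1"
    using i by (intro tendsto_divide g_lim nonneg sum_lim) auto
  moreover have "\<forall>\<^sub>F k in sequentially. (real (g k (p ! i)) / real k) / (real (sum_list (m k)) / real k)
      = real (m k ! i) / real (sum_list (m k))"
    using eventually_gt_at_top[of 0] by eventually_elim (simp add: m_def i)
  ultimately show "(\<lambda>k. real (m k ! i) / real (sum_list (m k))) \<longlonglongrightarrow> p ! i"
    unfolding div_by_1 by (rule Lim_transform_eventually)
qed

theorem mainTheorem1:
  fixes q :: real and S :: "real list \<Rightarrow> real"
  assumes "q > 0" and "q \<noteq> 1"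
    and "order_independent S"
    and "continuous_entropy S" and "maximal_at_equiprob S"
    and "nonextensive_additive q S"
    and "expandable S"
  shows "\<forall>p. prob_dist p \<longrightarrow> S p = tsallis_entropy q p"
proof (intro allI impI)
  interpret tsallis_axioms q S by unfold_locales (fact assms)+
  fix p :: "real list" assume p: "prob_dist p"
  define W where "W = length p"
  obtain m where len: "\<And>k. length (m k) = W" and pos: "\<And>k. \<forall>n\<in>set (m k). 0 < n"
    and lim: "\<And>i. i < W \<Longrightarrow> (\<lambda>k. real (m k ! i) / real (sum_list (m k))) \<longlonglongrightarrow> p ! i"
    using rational_approximation[OF p] unfolding W_def by metis
  have "0 < W" using p by (auto simp: W_def prob_dist_def)
  \<comment> \<open>Continuity is stated for functions on \<open>nat\<close>, so lists are extended
    by 0; convergence then holds in every coordinate, which is convergence in the product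
    topology.\<close>
  define x where "x k i = (if i < W then real (m k ! i) / real (sum_list (m k)) else 0)" for k i
  define y where "y i = (if i < W then p ! i else 0)" for i
  have x_map: "map (x k) [0..<W] = map (\<lambda>n. real n / real (sum_list (m k))) (m k)" for k
    by (rule nth_equalityI) (simp_all add: x_def len)
  have y_map: "map y [0..<W] = p" by (rule nth_equalityI) (simp_all add: y_def W_def)
  have x_lim: "(\<lambda>k. x k i) \<longlonglongrightarrow> y i" for i using lim by (simp add: x_def y_def)
  have m_ne: "m k \<noteq> []" for k using len[of k] \<open>0 < W\<close> by auto
  have x_pd: "prob_dist (map (x k) [0..<W])" for k
  proof -
    have M: "0 < sum_list (m k)" using pos[of k] m_ne[of k] by (cases "m k") auto
    have "(\<Sum>n\<leftarrow>m k. real n / real (sum_list (m k))) =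
        (\<Sum>n\<leftarrow>m k. real n) * (1 / real (sum_list (m k)))"
      by (subst sum_list_mult_const[symmetric]) simp
    also have "\<dots> = 1"
      using M by (simp add: sum_list_of_nat del: sum_list_eq_0_iff)
    finally show ?thesis using m_ne[of k] unfolding x_map prob_dist_def by (intro conjI ballI) auto
  qed
  let ?D = "{z :: nat \<Rightarrow> real. prob_dist (map z [0..<W])}"
  have "continuous_on ?D (\<lambda>z. S (map z [0..<W]))"
    using assms(4) by (simp add: continuous_entropy_def)
  moreover have "x \<longlonglongrightarrow> y"
    using x_lim limitin_componentwise[of "\<lambda>_. euclidean :: real topology" UNIV x y sequentially]
    by (simp add: euclidean_product_topology)
  ultimately have "(\<lambda>k. S (map (x k) [0..<W])) \<longlonglongrightarrow> S (map y [0..<W])"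
    by (rule continuous_on_tendsto_compose) (use x_pd p y_map in auto)
  then have "(\<lambda>k. F (map (x k) [0..<W])) \<longlonglongrightarrow> F p"
    unfolding F_def y_map by (intro tendsto_intros)
  moreover have "F (map (x k) [0..<W]) = (\<Sum>i<W. x k i powr q)" for k
    using F_rational[OF m_ne pos, of k] unfolding x_map[symmetric]
    by (simp add: sum_list_sum_nth atLeast0LessThan)
  \<comment> \<open>Where \<open>y i = 0\<close>, the limit of the powers relies on
    \<open>q > 0\<close> and on \<open>x k i\<close> being nonnegative.\<close>
  moreover have "(\<lambda>k. \<Sum>i<W. x k i powr q) \<longlonglongrightarrow> (\<Sum>i<W. y i powr q)"
    using assms(1) by (intro tendsto_sum tendsto_powr' x_lim) (auto simp: x_def)
  moreover have "(\<Sum>i<W. y i powr q) = (\<Sum>z\<leftarrow>p. z powr q)"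
    by (simp add: y_def W_def sum_list_sum_nth atLeast0LessThan)
  ultimately have "F p = (\<Sum>z\<leftarrow>p. z powr q)" using LIMSEQ_unique by auto
  then show "S p = tsallis_entropy q p"
    using assms(2) by (simp add: F_def tsallis_entropy_def field_simps)
qed

end
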